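(* Let $\mathcal{S}=\{S_1,\ldots,S_d\}$ be a partition of $\mathbb{N}_n$ into nonempty sets and let $\mathbf{A}\in\mathbb{R}^{p\times n}$ satisfy $(\mathbf{A}_{(j)})^\top\mathbf{A}_{(k)}=\mathbf{0}$ for all $j,k\in\mathbb{N}_d$ with $j\neq k$. Let $\mathbf{x}\in\mathbb{R}^p$ be such that the minimal norm problem $\min\{\|\mathbf{u}\|_1:\mathbf{A}\mathbf{u}=\mathbf{x},\ \mathbf{u}\in\mathbb{R}^n\}$ has a unique solution $\tilde{\mathbf{u}}$. Then there exist constants $\beta_1,\beta_2>0$ such that for every $\delta>0$ and every $\mathbf{x}^\delta\in\mathbb{R}^p$ with $\|\mathbf{x}^\delta-\mathbf{x}\|_2\leq\delta$, the following hold, where $a^\delta_j:=\|(\mathbf{A}_{(j)})^\top\mathbf{x}^\delta\|_\infty$, $j\in\mathbb{N}_d$, is rearranged in nondecreasing order as $a^\delta_{k_1}\leq a^\delta_{k_2}\leq\cdots\leq a^\delta_{k_d}$ with distinct $k_i\in\mathbb{N}_d$. (i) If $\lambda:=a^\delta_{k_{d-l}}$ for a given $l\in\{0,1,\ldots,d-1\}$ with $a^\delta_{k_{d-l}}>0$, then the regularization problem $$\min\Big\{\tfrac12\|\mathbf{A}\mathbf{u}-\mathbf{x}^\delta\|_2^2+\lambda\|\mathbf{u}\|_1:\mathbf{u}\in\mathbb{R}^n\Big\}$$ has a solution $\mathbf{u}^\delta_\lambda$ with $\mathcal{S}$-block sparsity of level $\leq l$ satisfying $$\|\mathbf{u}^\delta_\lambda-\tilde{\mathbf{u}}\|_2\leq\frac{a^\delta_{k_{d-l}}\beta_2^2}{2\beta_1}+\frac{\delta^2}{2a^\delta_{k_{d-l}}\beta_1}+\frac{\beta_2\delta}{\sqrt{2}\beta_1}.$$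 (ii) If $\lambda:=C\delta$ for a constant $C>0$, then the same regularization problem has a solution $\mathbf{u}^\delta_\lambda$ with $\mathcal{S}$-block sparsity of level $l$ satisfying $$\|\mathbf{u}^\delta_\lambda-\tilde{\mathbf{u}}\|_2\leq C'\delta,\qquad C':=\frac{C^2\beta_2^2+\sqrt{2}C\beta_2+1}{2C\beta_1},$$ where $l\in\{0,1,\ldots,d\}$ satisfies $a^\delta_{k_{d-l}}\leq C\delta<a^\delta_{k_{d-l+1}}$ (with the conventions $a^\delta_{k_0}:=0$ and $a^\delta_{k_{d+1}}:=+\infty$).
   Context: $\mathbb{N}_d:=\{1,\ldots,d\}$. For a matrix $\mathbf{A}\in\mathbb{R}^{p\times n}$ with columns $\mathbf{A}_1,\ldots,\mathbf{A}_n$, $\mathbf{A}_{(j)}:=[\mathbf{A}_k:k\in S_j]$ is the sub-matrix of the columns indexed by $S_j$ (in increasing order). For $\mathbf{u}\in\mathbb{R}^n$, its sub-vector $\mathbf{u}_j$ consists of the components $u_k$, $k\in S_j$; $\mathbf{u}$ has $\mathcal{S}$-block sparsity of level $l$ if exactly $l$ of the sub-vectors $\mathbf{u}_1,\ldots,\mathbf{u}_d$ are nonzero. A solution of a minimization problem is a point at which the minimum is attained. *)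

theory Defs
  imports "HOL-Analysis.Analysis"
begin

definition l1_norm :: "real ^ 'n \<Rightarrow> real" where
  "l1_norm u = (\<Sum>i\<in>UNIV. \<bar>u $ i\<bar>)"

text \<open>The index set of the partition is the finite type \<open>'n\<close>. The width of a block varies from
  block to block, so a sub-matrix (sub-vector) supported on \<open>J\<close> keeps the ambient type and has
  its columns (components) outside \<open>J\<close> set to zero; this is the usual identification of the
  vectors indexed by \<open>J\<close> with a coordinate subspace. The lemmas following the definitions
  confirm that products and norms agree with those of the unpadded blocks.\<close>

definition submat :: "real ^ 'n ^ 'p \<Rightarrow> 'n set \<Rightarrow> real ^ 'n ^ 'p" where
  "submat A J = (\<chi> i k. if k \<in> J then A $ i $ k else 0)"

definition subvec :: "real ^ 'n \<Rightarrow> 'n set \<Rightarrow> real ^ 'n" where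
  "subvec u J = (\<chi> k. if k \<in> J then u $ k else 0)"

lemma subvec_eq_0_iff: "subvec u J = 0 \<longleftrightarrow> (\<forall>k\<in>J. u $ k = 0)"
  by (auto simp: subvec_def vec_eq_iff)

lemma transpose_submat_mult_submat:
  "(transpose (submat A J) ** submat A K) $ s $ t =
    (if s \<in> J \<and> t \<in> K then column s A \<bullet> column t A else 0)"
  by (cases "s \<in> J"; cases "t \<in> K")
    (simp_all add: submat_def matrix_matrix_mult_def transpose_def column_def inner_vec_def)

lemma transpose_submat_mult_submat_eq_0_iff:
  "transpose (submat A J) ** submat A K = 0 \<longleftrightarrow>
    (\<forall>s\<in>J. \<forall>t\<in>K. column s A \<bullet> column t A = 0)"
  by (auto simp: vec_eq_iff transpose_submat_mult_submat)

lemma transpose_submat_mult_vec: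
  "(transpose (submat A J) *v y) $ s = (if s \<in> J then column s A \<bullet> y else 0)"
  by (simp add: submat_def matrix_vector_mult_def transpose_def column_def inner_vec_def)

lemma infnorm_transpose_submat_mult_vec:
  assumes "J \<noteq> {}"
  shows "infnorm (transpose (submat A J) *v y) = Max ((\<lambda>s. \<bar>column s A \<bullet> y\<bar>) ` J)"
proof -
  let ?v = "transpose (submat A J) *v y"
  have "infnorm ?v = Sup ((\<lambda>s. \<bar>?v $ s\<bar>) ` UNIV)"
    unfolding infnorm_cart by (simp add: full_SetCompr_eq)
  also have "\<dots> = Max ((\<lambda>s. \<bar>?v $ s\<bar>) ` UNIV)"
    by (rule cSup_eq_Max) auto
  also have "\<dots> = Max ((\<lambda>s. \<bar>column s A \<bullet> y\<bar>) ` J)"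
  proof (rule Max_eqI)
    fix r assume "r \<in> (\<lambda>s. \<bar>?v $ s\<bar>) ` UNIV"
    then obtain s where r: "r = \<bar>?v $ s\<bar>" by auto
    obtain t where "t \<in> J" using assms by auto
    then have "0 \<le> \<bar>column t A \<bullet> y\<bar>" "\<bar>column t A \<bullet> y\<bar> \<le> Max ((\<lambda>s. \<bar>column s A \<bullet> y\<bar>) ` J)"
      by auto
    then show "r \<le> Max ((\<lambda>s. \<bar>column s A \<bullet> y\<bar>) ` J)"
      by (cases "s \<in> J") (simp_all add: r transpose_submat_mult_vec del: transpose_matrix_vector)
  next
    have "Max ((\<lambda>s. \<bar>column s A \<bullet> y\<bar>) ` J) \<in> (\<lambda>s. \<bar>column s A \<bullet> y\<bar>) ` J"
      using assms by (intro Max_in) auto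
    then obtain t where "t \<in> J" "Max ((\<lambda>s. \<bar>column s A \<bullet> y\<bar>) ` J) = \<bar>column t A \<bullet> y\<bar>"
      by auto
    then show "Max ((\<lambda>s. \<bar>column s A \<bullet> y\<bar>) ` J) \<in> (\<lambda>s. \<bar>?v $ s\<bar>) ` UNIV"
      by (auto simp: transpose_submat_mult_vec simp del: transpose_matrix_vector intro!: image_eqI[where x = t])
  qed simp
  finally show ?thesis .
qed

definition block_sparsity :: "nat \<Rightarrow> (nat \<Rightarrow> 'n set) \<Rightarrow> real ^ 'n \<Rightarrow> nat" where
  "block_sparsity d S u = card {j \<in> {1..d}. subvec u (S j) \<noteq> 0}"

definition reg_solution ::
    "real ^ 'n ^ 'p \<Rightarrow> real ^ 'p \<Rightarrow> real \<Rightarrow> real ^ 'n \<Rightarrow> bool" where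
  "reg_solution A y lam u \<longleftrightarrow>
    is_arg_min (\<lambda>v. 1 / 2 * (norm (A *v v - y))\<^sup>2 + lam * l1_norm v) (\<lambda>_. True) u"

definition min_norm_solution :: "real ^ 'n ^ 'p \<Rightarrow> real ^ 'p \<Rightarrow> real ^ 'n \<Rightarrow> bool" where
  "min_norm_solution A x u \<longleftrightarrow> is_arg_min l1_norm (\<lambda>v. A *v v = x) u"

definition nondecreasing_rearrangement ::
    "nat \<Rightarrow> (nat \<Rightarrow> real) \<Rightarrow> (nat \<Rightarrow> nat) \<Rightarrow> bool" where
  "nondecreasing_rearrangement d a k \<longleftrightarrow>
    bij_betw k {1..d} {1..d} \<and> (\<forall>i\<in>{1..d}. \<forall>j\<in>{1..d}. i \<le> j \<longrightarrow> a (k i) \<le> a (k j))"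

text \<open>The rearranged values, with the conventional values \<open>0\<close> at position \<open>0\<close> and
  \<open>\<infinity>\<close> at position \<open>d + 1\<close>.\<close>

definition rearranged_ext :: "nat \<Rightarrow> (nat \<Rightarrow> real) \<Rightarrow> (nat \<Rightarrow> nat) \<Rightarrow> nat \<Rightarrow> ereal" where
  "rearranged_ext d a k i =
    (if i = 0 then 0 else if i = d + 1 then \<infinity> else ereal (a (k i)))"

end

theory Submission
  imports Defs
begin

text \<open>The directional derivative of the \<open>\<ell>\<^sub>1\<close>-norm at the unique solution is positive on the nonzero
  kernel directions of \<open>A\<close>; by compactness of the unit sphere it stays positive in every direction
  after a multiple of \<open>\<parallel>A h\<parallel>\<close> is added. This sharpness inequality, combined with the minimality of
  the regularized solution and AM-GM, gives both error bounds. Orthogonality of the blocks decouples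
  the regularization problem: a block of a solution is nonzero iff \<open>a\<^sub>j > \<lambda>\<close>, so the block sparsity
  of any solution is the number of such \<open>j\<close>.\<close>

section \<open>Sharpness of a unique minimal norm solution\<close>

text \<open>The one-sided directional derivative of \<open>l1_norm\<close> at \<open>u\<close> along
  \<open>h\<close>: a coordinate in the support of \<open>u\<close> contributes linearly, and one at
  the kink of the absolute value contributes \<open>\<bar>h $ i\<bar>\<close>.\<close>

definition l1_dir :: "real ^ 'n \<Rightarrow> real ^ 'n \<Rightarrow> real" where
  "l1_dir u h = (\<Sum>i\<in>UNIV. if u $ i = 0 then \<bar>h $ i\<bar> else sgn (u $ i) * h $ i)"

text \<open>Convexity, coordinate by coordinate. No smallness of \<open>h\<close> is assumed, which
  is what later turns information about directions into a global bound.\<close>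

lemma l1_dir_le: "l1_dir u h \<le> l1_norm (u + h) - l1_norm u"
  unfolding l1_dir_def l1_norm_def sum_subtractf[symmetric]
  by (rule sum_mono) (auto simp: sgn_if abs_if)

lemma l1_dir_scaleR: "t \<ge> 0 \<Longrightarrow> l1_dir u (t *\<^sub>R h) = t * l1_dir u h"
  by (auto simp: l1_dir_def sum_distrib_left abs_mult intro!: sum.cong)

lemma continuous_on_l1_dir: "continuous_on T (l1_dir u)"
  unfolding l1_dir_def
proof (intro continuous_on_sum)
  show "continuous_on T (\<lambda>h. if u $ i = 0 then \<bar>h $ i\<bar> else sgn (u $ i) * h $ i)" for i
    by (cases "u $ i = 0") (auto intro!: continuous_intros)
qed

text \<open>No coordinate in the support of \<open>u\<close> changes sign, so the convexity
  inequality becomes an equality.\<close>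

lemma l1_norm_add_small:
  assumes "\<And>i. u $ i \<noteq> 0 \<Longrightarrow> \<bar>h $ i\<bar> \<le> \<bar>u $ i\<bar>"
  shows "l1_norm (u + h) = l1_norm u + l1_dir u h"
  unfolding l1_dir_def l1_norm_def sum.distrib[symmetric]
proof (rule sum.cong)
  fix i
  show "\<bar>(u + h) $ i\<bar> = \<bar>u $ i\<bar> + (if u $ i = 0 then \<bar>h $ i\<bar> else sgn (u $ i) * h $ i)"
    using assms[of i] by (auto simp: sgn_if abs_if split: if_splits)
qed simp

text \<open>A step along the kernel stays feasible. If it is short, the norm changes by exactly the
  step length times \<open>l1_dir ut h\<close>, and uniqueness forces this change to be
  positive.\<close>

lemma l1_dir_pos:
  fixes A :: "real ^ 'n ^ 'p"
  assumes solution: "min_norm_solution A x ut"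
    and unique: "\<And>u. min_norm_solution A x u \<Longrightarrow> u = ut"
    and ker: "A *v h = 0" and "h \<noteq> 0"
  shows "l1_dir ut h > 0"
proof -
  have "\<exists>t>0. \<forall>i. ut $ i \<noteq> 0 \<longrightarrow> t * \<bar>h $ i\<bar> \<le> \<bar>ut $ i\<bar>"
  proof -
    \<comment> \<open>The step length is \<open>?m / norm h\<close>, with \<open>?m\<close> at most
      the smallest nonzero modulus in \<open>ut\<close>; inserting 1 covers
      \<open>ut = 0\<close>.\<close>
    let ?m = "Min (insert 1 ((\<lambda>i. \<bar>ut $ i\<bar>) ` {i. ut $ i \<noteq> 0}))"
    have m: "?m > 0" by (subst Min_gr_iff) auto
    have h: "norm h > 0" using \<open>h \<noteq> 0\<close> by simp
    have "?m / norm h * \<bar>h $ i\<bar> \<le> \<bar>ut $ i\<bar>" if "ut $ i \<noteq> 0" for i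
    proof -
      have "?m / norm h * \<bar>h $ i\<bar> \<le> ?m / norm h * norm h"
        using m h component_le_norm_cart[of h i] by (intro mult_left_mono) auto
      also have "\<dots> = ?m" using h by simp
      also have "\<dots> \<le> \<bar>ut $ i\<bar>" using that by (intro Min_le) auto
      finally show ?thesis .
    qed
    moreover have "?m / norm h > 0" using m h by simp
    ultimately show ?thesis by blast
  qed
  then obtain t where t: "t > 0" "\<And>i. ut $ i \<noteq> 0 \<Longrightarrow> t * \<bar>h $ i\<bar> \<le> \<bar>ut $ i\<bar>" by blast
  have Aut: "A *v ut = x" and min: "\<And>v. A *v v = x \<Longrightarrow> l1_norm ut \<le> l1_norm v"
    using solution by (auto simp: min_norm_solution_def is_arg_min_linorder)
  have Ath: "A *v (ut + t *\<^sub>R h) = x"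
    using ker Aut by (simp add: matrix_vector_right_distrib matrix_vector_mult_scaleR)
  have "ut + t *\<^sub>R h \<noteq> ut" using t(1) \<open>h \<noteq> 0\<close> by simp
  then have "\<not> min_norm_solution A x (ut + t *\<^sub>R h)" using unique by blast
  then have "l1_norm ut < l1_norm (ut + t *\<^sub>R h)"
    using Ath min unfolding min_norm_solution_def is_arg_min_linorder
    by (meson order_trans not_le)
  also have "l1_norm (ut + t *\<^sub>R h) = l1_norm ut + t * l1_dir ut h"
    using t by (subst l1_norm_add_small) (auto simp: abs_mult l1_dir_scaleR)
  finally show ?thesis using t(1) by (simp add: zero_less_mult_iff)
qed

text \<open>Positivity of \<open>?g M\<close> on the unit sphere extends to all directions by
  homogeneity, and \<open>l1_dir_le\<close> then replaces the derivative by the actual difference of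
  norms, however far \<open>u\<close> is from \<open>ut\<close>.\<close>

lemma unique_min_norm_solution_sharp:
  fixes A :: "real ^ 'n ^ 'p"
  assumes "min_norm_solution A x ut"
    and "\<And>u. min_norm_solution A x u \<Longrightarrow> u = ut"
  obtains b M where "b > 0" "M > 0"
    "\<And>u. b * norm (u - ut) \<le> l1_norm u - l1_norm ut + M * norm (A *v u - x)"
proof -
  let ?S = "sphere (0 :: real ^ 'n) 1"
  let ?g = "\<lambda>M h. l1_dir ut h + M * norm (A *v h)"
  have Aut: "A *v ut = x"
    using assms(1) by (auto simp: min_norm_solution_def is_arg_min_linorder)
  have cont: "continuous_on T (?g M)" for M T
    by (intro continuous_intros continuous_on_l1_dir)
  \<comment> \<open>These open sets increase with \<open>m\<close>, so the largest index in a finite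
    subcover of the sphere gives one weight for all directions.\<close>
  define U where "U m = {h. ?g (real (Suc m)) h > 0}" for m
  have "open (U m)" for m
    unfolding U_def by (intro open_Collect_less cont continuous_on_const)
  moreover have "?S \<subseteq> (\<Union>m. U m)"
  proof
    fix h assume h: "h \<in> ?S"
    show "h \<in> (\<Union>m. U m)"
    proof (cases "A *v h = 0")
      case True
      have "h \<noteq> 0" using h by auto
      with assms True have "l1_dir ut h > 0" by (rule l1_dir_pos)
      then show ?thesis using True by (auto simp: U_def)
    next
      case False
      then obtain m where "real m * norm (A *v h) > - l1_dir ut h"
        using reals_Archimedean3[of "norm (A *v h)"] by auto
      then have "?g (real (Suc m)) h > 0"
        using norm_ge_zero[of "A *v h"] by (simp add: algebra_simps del: norm_ge_zero)
      then show ?thesis unfolding U_def by blast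
    qed
  qed
  ultimately obtain I where I: "finite I" "?S \<subseteq> (\<Union>m\<in>I. U m)"
    using compactE_image[of ?S UNIV U] compact_sphere by (metis UNIV_I)
  define M where "M = real (Suc (Max (insert 0 I)))"
  have pos: "?g M h > 0" if h: "h \<in> ?S" for h
  proof -
    obtain m where m: "m \<in> I" "?g (real (Suc m)) h > 0" using I h by (auto simp: U_def)
    have "real (Suc m) \<le> M" unfolding M_def using I m by simp
    then have "real (Suc m) * norm (A *v h) \<le> M * norm (A *v h)" by (intro mult_right_mono) auto
    then show ?thesis using m by linarith
  qed
  \<comment> \<open>An arbitrary unit vector shows that the sphere is nonempty, so the minimum
    \<open>b\<close> of \<open>?g M\<close> is attained there.\<close>
  have "axis undefined 1 \<in> ?S" by (simp add: norm_axis_1)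
  then obtain h0 where h0: "h0 \<in> ?S" "\<And>h. h \<in> ?S \<Longrightarrow> ?g M h0 \<le> ?g M h"
    using continuous_attains_inf[of ?S "?g M"] cont compact_sphere by blast
  define b where "b = ?g M h0"
  have "b * norm (u - ut) \<le> l1_norm u - l1_norm ut + M * norm (A *v u - x)" for u
  proof (cases "u = ut")
    case True
    then show ?thesis using Aut by simp
  next
    case False
    define n where "n = norm (u - ut)"
    define h where "h = (1 / n) *\<^sub>R (u - ut)"
    have n: "n > 0" using False by (simp add: n_def)
    have "u - ut = n *\<^sub>R h" using n by (simp add: h_def)
    have "h \<in> ?S" using n by (simp add: h_def n_def)
    then have "b * n \<le> ?g M h * n" using h0(2) n by (intro mult_right_mono) (auto simp: b_def)
    also have "\<dots> = l1_dir ut (u - ut) + M * norm (A *v (u - ut))"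
      unfolding \<open>u - ut = n *\<^sub>R h\<close> using n
      by (simp add: l1_dir_scaleR matrix_vector_mult_scaleR algebra_simps)
    also have "l1_dir ut (u - ut) \<le> l1_norm u - l1_norm ut" using l1_dir_le[of ut "u - ut"] by simp
    finally show ?thesis by (simp add: n_def matrix_vector_mult_diff_distrib Aut)
  qed
  moreover have "b > 0" using pos h0(1) by (simp add: b_def)
  moreover have "M > 0" by (simp add: M_def)
  ultimately show ?thesis using that by blast
qed

section \<open>Solutions of the regularization problem\<close>

lemma reg_solution_le:
  assumes "reg_solution A y lam u"
  shows "1 / 2 * (norm (A *v u - y))\<^sup>2 + lam * l1_norm u \<le>
    1 / 2 * (norm (A *v v - y))\<^sup>2 + lam * l1_norm v"
  using assms by (simp add: reg_solution_def is_arg_min_linorder)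

text \<open>Coercivity: outside the ball of radius \<open>?F 0 / lam\<close> the penalty alone
  exceeds the value at 0, so a minimizer on the ball is global.\<close>

lemma reg_solution_exists:
  fixes A :: "real ^ 'n ^ 'p"
  assumes "lam > 0"
  obtains u where "reg_solution A y lam u"
proof -
  let ?F = "\<lambda>v. 1 / 2 * (norm (A *v v - y))\<^sup>2 + lam * l1_norm v"
  let ?B = "cball (0 :: real ^ 'n) (?F 0 / lam)"
  have l1_0: "l1_norm (0 :: real ^ 'n) = 0" by (simp add: l1_norm_def)
  have "continuous_on ?B ?F"
    unfolding l1_norm_def
    by (intro continuous_intros)
  moreover have z: "0 \<in> ?B" using assms by (simp add: l1_0)
  ultimately obtain u where u: "u \<in> ?B" "\<And>v. v \<in> ?B \<Longrightarrow> ?F u \<le> ?F v"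
    using continuous_attains_inf[of ?B ?F] compact_cball by blast
  have "?F u \<le> ?F v" for v
  proof (cases "v \<in> ?B")
    case False
    then have "?F 0 < lam * norm v" using assms by (simp add: field_simps)
    also have "\<dots> \<le> lam * l1_norm v"
      using assms norm_le_l1_cart[of v] by (intro mult_left_mono) (auto simp: l1_norm_def)
    also have "\<dots> \<le> ?F v" by simp
    finally show ?thesis using u(2)[OF z] by linarith
  qed (use u in auto)
  then have "reg_solution A y lam u" by (simp add: reg_solution_def is_arg_min_linorder)
  then show ?thesis by (rule that)
qed

text \<open>Comparing \<open>u\<close> with \<open>ut\<close> in the regularized objective bounds
  \<open>lam * (l1_norm u - l1_norm ut)\<close> by half of
  \<open>\<delta>\<^sup>2 - r\<^sup>2\<close>. Multiplying sharpness by \<open>lam\<close> leaves a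
  term \<open>lam * M * r\<close>, which the negative square of the residual absorbs.\<close>

lemma reg_solution_error:
  fixes A :: "real ^ 'n ^ 'p"
  assumes "reg_solution A y lam u" "lam > 0" "b > 0" "M > 0" "norm (y - A *v ut) \<le> \<delta>"
    and sharp: "b * norm (u - ut) \<le> l1_norm u - l1_norm ut + M * norm (A *v u - A *v ut)"
  shows "norm (u - ut) \<le>
    lam * (sqrt 2 * M)\<^sup>2 / (2 * b) + \<delta>\<^sup>2 / (2 * lam * b) + sqrt 2 * M * \<delta> / (sqrt 2 * b)"
proof -
  define r where "r = norm (A *v u - y)"
  have "norm (A *v u - A *v ut) \<le> r + \<delta>"
    using norm_triangle_ineq[of "A *v u - y" "y - A *v ut"] assms(5) by (simp add: r_def)
  then have "M * norm (A *v u - A *v ut) \<le> M * (r + \<delta>)" using assms(4) by simp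
  with sharp have "b * norm (u - ut) \<le> l1_norm u - l1_norm ut + M * (r + \<delta>)" by linarith
  then have 1: "lam * (b * norm (u - ut)) \<le> lam * (l1_norm u - l1_norm ut + M * (r + \<delta>))"
    using assms(2) by simp
  have "(norm (A *v ut - y))\<^sup>2 \<le> \<delta>\<^sup>2"
    using assms(5) by (intro power_mono) (auto simp: norm_minus_commute)
  then have 2: "1 / 2 * r\<^sup>2 + lam * l1_norm u \<le> 1 / 2 * \<delta>\<^sup>2 + lam * l1_norm ut"
    using reg_solution_le[OF assms(1), of ut] by (simp add: r_def)
  have "0 \<le> (r - lam * M)\<^sup>2" by simp
  then have "lam * M * r \<le> 1 / 2 * r\<^sup>2 + 1 / 2 * (lam * M)\<^sup>2"
    by (simp add: power2_eq_square algebra_simps)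
  with 1 2 have "lam * (b * norm (u - ut)) \<le> 1 / 2 * \<delta>\<^sup>2 + 1 / 2 * (lam * M)\<^sup>2 + lam * M * \<delta>"
    by (simp add: algebra_simps)
  \<comment> \<open>The factor \<open>sqrt 2 * M\<close> is chosen so that the mixed term becomes
    \<open>M * \<delta> / b\<close>; its square then allows \<open>lam * M\<^sup>2 / b\<close>,
    twice what AM-GM leaves.\<close>
  also have "\<dots> \<le> 1 / 2 * \<delta>\<^sup>2 + (lam * M)\<^sup>2 + lam * M * \<delta>" by simp
  finally have "norm (u - ut) \<le> (1 / 2 * \<delta>\<^sup>2 + (lam * M)\<^sup>2 + lam * M * \<delta>) / (lam * b)"
    using assms(2,3) by (simp add: pos_le_divide_eq mult_ac)
  also have "\<dots> = lam * (sqrt 2 * M)\<^sup>2 / (2 * b) + \<delta>\<^sup>2 / (2 * lam * b) + sqrt 2 * M * \<delta> / (sqrt 2 * b)"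
    using assms(2,3) by (simp add: field_simps power2_eq_square)
  finally show ?thesis .
qed

section \<open>Nonzero blocks of a regularized solution\<close>

lemma matrix_vector_mult_inner:
  fixes A :: "real ^ 'n ^ 'p"
  shows "(A *v u) \<bullet> y = (\<Sum>s\<in>UNIV. u $ s * (column s A \<bullet> y))"
  unfolding matrix_mult_sum by (simp add: inner_sum_left scalar_mult_eq_scaleR)

lemma column_inner_mult_eq_0:
  fixes A :: "real ^ 'n ^ 'p"
  assumes "\<And>t. t \<notin> J \<Longrightarrow> column t A \<bullet> column s A = 0" "\<And>t. t \<in> J \<Longrightarrow> u $ t = 0"
  shows "(A *v u) \<bullet> column s A = 0"
  unfolding matrix_vector_mult_inner using assms by (metis (mono_tags) mult_eq_0_iff sum.neutral)

text \<open>Compare \<open>u\<close> with \<open>u - w\<close>, where the block \<open>w\<close> is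
  deleted. By orthogonality minimality reads \<open>lam * l1_norm w \<le> v \<bullet> y - 1 / 2 * (v
  \<bullet> v)\<close>, while \<open>v \<bullet> y\<close> is at most
  \<open>?m * l1_norm w\<close>.\<close>

lemma reg_solution_block_nonzeroD:
  fixes A :: "real ^ 'n ^ 'p"
  assumes sol: "reg_solution A y lam u" and lam: "lam > 0"
    and orth: "\<And>s t. s \<in> J \<Longrightarrow> t \<notin> J \<Longrightarrow> column t A \<bullet> column s A = 0"
    and nz: "subvec u J \<noteq> 0"
  shows "infnorm (transpose (submat A J) *v y) > lam"
proof (rule ccontr)
  let ?m = "infnorm (transpose (submat A J) *v y)"
  define w where "w = subvec u J"
  define v where "v = A *v w"
  assume "\<not> ?m > lam"
  have bound: "\<bar>column s A \<bullet> y\<bar> \<le> ?m" if "s \<in> J" for s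
    using component_le_infnorm_cart[of "transpose (submat A J) *v y" s] that
    unfolding transpose_submat_mult_vec by simp
  have l1w: "l1_norm w > 0"
    using nz norm_le_l1_cart[of w] unfolding w_def[symmetric] l1_norm_def
    by (meson zero_less_norm_iff less_le_trans)
  have "v \<bullet> y \<le> (\<Sum>s\<in>UNIV. \<bar>w $ s\<bar> * ?m)"
    unfolding v_def matrix_vector_mult_inner
  proof (rule sum_mono)
    fix s
    show "w $ s * (column s A \<bullet> y) \<le> \<bar>w $ s\<bar> * ?m"
    proof (cases "s \<in> J")
      case True
      have "w $ s * (column s A \<bullet> y) \<le> \<bar>w $ s\<bar> * \<bar>column s A \<bullet> y\<bar>"
        by (metis abs_ge_self abs_mult)
      also have "\<dots> \<le> \<bar>w $ s\<bar> * ?m" using bound[OF True] by (intro mult_left_mono) auto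
      finally show ?thesis .
    qed (simp add: w_def subvec_def)
  qed
  also have "\<dots> = ?m * l1_norm w" by (simp add: l1_norm_def sum_distrib_left mult.commute)
  also have "\<dots> \<le> lam * l1_norm w" using \<open>\<not> ?m > lam\<close> l1w by simp
  finally have vy: "v \<bullet> y \<le> lam * l1_norm w" .
  \<comment> \<open>\<open>w\<close> lives on \<open>J\<close> and \<open>u - w\<close> off
    \<open>J\<close>, so only inner products between different blocks occur.\<close>
  have "v \<bullet> (A *v (u - w)) = 0"
    unfolding v_def matrix_vector_mult_inner
  proof (intro sum.neutral ballI)
    fix s
    show "w $ s * (column s A \<bullet> (A *v (u - w))) = 0"
    proof (cases "s \<in> J")
      case True
      have "(A *v (u - w)) \<bullet> column s A = 0"
        by (rule column_inner_mult_eq_0[of J]) (use orth True in \<open>auto simp: w_def subvec_def\<close>)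
      then show ?thesis by (simp add: inner_commute)
    qed (simp add: w_def subvec_def)
  qed
  then have vu: "v \<bullet> (A *v u) = v \<bullet> v"
    by (simp add: matrix_vector_mult_diff_distrib inner_diff_right v_def)
  have "A *v (u - w) - y = (A *v u - y) - v" by (simp add: matrix_vector_mult_diff_distrib v_def)
  then have fit: "(norm (A *v (u - w) - y))\<^sup>2 = (norm (A *v u - y))\<^sup>2 - v \<bullet> v + 2 * (v \<bullet> y)"
    by (simp only: power2_norm_eq_inner) (use vu in \<open>simp add: inner_diff inner_commute algebra_simps\<close>)
  have "l1_norm u = l1_norm (u - w) + l1_norm w"
    unfolding l1_norm_def sum.distrib[symmetric]
    by (rule sum.cong) (auto simp: w_def subvec_def)
  then have "lam * l1_norm u = lam * l1_norm (u - w) + lam * l1_norm w"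
    by (simp add: distrib_left)
  with reg_solution_le[OF sol, of "u - w"] fit
  have main: "lam * l1_norm w \<le> v \<bullet> y - 1 / 2 * (v \<bullet> v)" by simp
  \<comment> \<open>The quadratic term settles the borderline case \<open>?m = lam\<close>: it
    forces \<open>v = 0\<close>, so \<open>v \<bullet> y\<close> vanishes as well and cannot pay for
    the penalty of \<open>w\<close>.\<close>
  then have "v \<bullet> v \<le> 0" using vy by linarith
  then have "v = 0" by (metis inner_ge_zero inner_eq_zero_iff order_antisym)
  with main have "lam * l1_norm w \<le> 0" by simp
  then show False using lam l1w by (simp add: mult_le_0_iff)
qed

text \<open>If the block were zero, some column \<open>c\<close> in it would have correlation with
  \<open>y\<close> above \<open>lam\<close>. Switching on that coordinate by a small amount gains
  more in the fit than it costs in the penalty.\<close>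

lemma reg_solution_block_nonzeroI:
  fixes A :: "real ^ 'n ^ 'p"
  assumes sol: "reg_solution A y lam u" and lam: "lam > 0" and "J \<noteq> {}"
    and orth: "\<And>s t. s \<in> J \<Longrightarrow> t \<notin> J \<Longrightarrow> column t A \<bullet> column s A = 0"
    and gt: "infnorm (transpose (submat A J) *v y) > lam"
  shows "subvec u J \<noteq> 0"
proof
  assume "subvec u J = 0"
  then have u0: "\<And>s. s \<in> J \<Longrightarrow> u $ s = 0" by (simp add: subvec_eq_0_iff)
  have "Max ((\<lambda>s. \<bar>column s A \<bullet> y\<bar>) ` J) \<in> (\<lambda>s. \<bar>column s A \<bullet> y\<bar>) ` J"
    using \<open>J \<noteq> {}\<close> by (intro Max_in) auto
  then obtain s where s: "s \<in> J" "\<bar>column s A \<bullet> y\<bar> > lam"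
    using gt infnorm_transpose_submat_mult_vec[OF \<open>J \<noteq> {}\<close>, of A y] by auto
  define c where "c = column s A"
  have cu: "(A *v u) \<bullet> c = 0"
    unfolding c_def by (rule column_inner_mult_eq_0[of J]) (use orth s u0 in auto)
  have cy: "c \<bullet> y \<noteq> 0" using s lam by (auto simp: c_def)
  have step: "\<bar>c \<bullet> y\<bar> - lam \<le> e * (c \<bullet> c) / 2" if e: "e > 0" for e
  proof -
    \<comment> \<open>The sign makes the linear term of the fit decrease; the objective then changes
      by \<open>- e * (\<bar>c \<bullet> y\<bar> - lam) + e\<^sup>2 * (c \<bullet> c) /
      2\<close>.\<close>
    define t where "t = e * sgn (c \<bullet> y)"
    have t: "\<bar>t\<bar> = e" "t * (c \<bullet> y) = e * \<bar>c \<bullet> y\<bar>" "t\<^sup>2 = e\<^sup>2"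
      using e cy by (auto simp: t_def sgn_if abs_if)
    let ?v = "u + t *\<^sub>R axis s 1"
    have Av: "A *v ?v - y = (A *v u - y) + t *\<^sub>R c"
      by (simp add: matrix_vector_right_distrib matrix_vector_mult_scaleR
          matrix_vector_mult_basis c_def)
    have fit: "(norm (A *v ?v - y))\<^sup>2 = (norm (A *v u - y))\<^sup>2 - 2 * (t * (c \<bullet> y)) + t\<^sup>2 * (c \<bullet> c)"
      unfolding Av power2_norm_eq_inner
      using cu by (simp add: inner_add inner_diff inner_commute power2_eq_square algebra_simps)
    have "l1_norm ?v = l1_norm u + \<bar>t\<bar>"
    proof -
      have "l1_norm ?v = (\<Sum>i\<in>UNIV. \<bar>u $ i\<bar> + (if i = s then \<bar>t\<bar> else 0))"
        unfolding l1_norm_def by (rule sum.cong) (use u0[OF s(1)] in \<open>auto simp: axis_def\<close>)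
      then show ?thesis by (simp add: sum.distrib l1_norm_def)
    qed
    then have "0 \<le> - (t * (c \<bullet> y)) + t\<^sup>2 * (c \<bullet> c) / 2 + lam * \<bar>t\<bar>"
      using reg_solution_le[OF sol, of ?v] unfolding fit by (simp add: distrib_left) argo
    then have "e * (\<bar>c \<bullet> y\<bar> - lam) \<le> e * (e * (c \<bullet> c) / 2)"
      unfolding t by (simp add: algebra_simps power2_eq_square)
    then show ?thesis using e by simp
  qed
  \<comment> \<open>The minimizer of this quadratic in \<open>e\<close>; with it \<open>step\<close>
    says that the positive gap is at most half of itself.\<close>
  define e where "e = (\<bar>c \<bullet> y\<bar> - lam) / (c \<bullet> c)"
  have "c \<noteq> 0" using cy by auto
  then have cc: "c \<bullet> c > 0" by simp
  moreover have gt: "\<bar>c \<bullet> y\<bar> - lam > 0" using s by (simp add: c_def)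
  ultimately have "e > 0" by (simp add: e_def)
  then show False using step[of e] cc gt by (simp add: e_def)
qed

text \<open>The criterion does not mention \<open>u\<close>, so all solutions for the same
  \<open>y\<close> and \<open>lam\<close> have the same nonzero blocks.\<close>

lemma reg_solution_block_nonzero_iff:
  fixes A :: "real ^ 'n ^ 'p"
  assumes "reg_solution A y lam u" "lam > 0" "J \<noteq> {}"
    and "\<And>s t. s \<in> J \<Longrightarrow> t \<notin> J \<Longrightarrow> column t A \<bullet> column s A = 0"
  shows "subvec u J \<noteq> 0 \<longleftrightarrow> infnorm (transpose (submat A J) *v y) > lam"
  using reg_solution_block_nonzeroD[OF assms(1,2,4)] reg_solution_block_nonzeroI[OF assms]
  by blast

text \<open>The blocks cover all indices, so a column outside one block lies in another, and
  pairwise orthogonality of blocks applies.\<close>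

lemma orthogonal_columns_of_partition:
  fixes A :: "real ^ 'n ^ 'p"
  assumes "\<Union> (S ` I) = UNIV"
    and "\<And>j k. j \<in> I \<Longrightarrow> k \<in> I \<Longrightarrow> j \<noteq> k \<Longrightarrow> transpose (submat A (S j)) ** submat A (S k) = 0"
    and "j \<in> I" "s \<in> S j" "t \<notin> S j"
  shows "column t A \<bullet> column s A = 0"
proof -
  obtain k where "k \<in> I" "t \<in> S k" using assms(1) by auto
  with assms show ?thesis by (metis transpose_submat_mult_submat_eq_0_iff)
qed

section \<open>Counting with a nondecreasing rearrangement\<close>

lemma card_rearranged:
  assumes "nondecreasing_rearrangement d a k"
  shows "card {j \<in> {1..d}. P (a j)} = card {i \<in> {1..d}. P (a (k i))}"
proof -
  have k: "bij_betw k {1..d} {1..d}" using assms by (simp add: nondecreasing_rearrangement_def)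
  then have "inj_on k {i \<in> {1..d}. P (a (k i))}"
    by (rule inj_on_subset[OF bij_betw_imp_inj_on]) blast
  moreover have "k ` {i \<in> {1..d}. P (a (k i))} = {j \<in> k ` {1..d}. P (a j)}" by blast
  moreover have "k ` {1..d} = {1..d}" using k by (rule bij_betw_imp_surj_on)
  ultimately show ?thesis using card_image by fastforce
qed

text \<open>By monotonicity the first \<open>i\<close> positions carry values at most
  \<open>c\<close>, leaving \<open>d - i\<close> candidates.\<close>

lemma card_gt_le:
  assumes "nondecreasing_rearrangement d a k" "i \<in> {1..d}" "a (k i) \<le> c"
  shows "card {j \<in> {1..d}. a j > c} \<le> d - i"
proof -
  have "a (k i') \<le> c" if "i' \<in> {1..d}" "i' \<le> i" for i'
    using assms that unfolding nondecreasing_rearrangement_def by (meson order_trans)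
  then have "{i' \<in> {1..d}. a (k i') > c} \<subseteq> {i<..d}" by (force simp: not_le[symmetric])
  then have "card {i' \<in> {1..d}. a (k i') > c} \<le> card {i<..d}" by (intro card_mono) auto
  then show ?thesis unfolding card_rearranged[OF assms(1), of "\<lambda>b. b > c"] by simp
qed

lemma card_gt_ge:
  assumes "nondecreasing_rearrangement d a k" "i \<in> {1..d}" "a (k i) > c"
  shows "card {j \<in> {1..d}. a j > c} \<ge> d + 1 - i"
proof -
  have "a (k i') > c" if "i' \<in> {1..d}" "i \<le> i'" for i'
    using assms that unfolding nondecreasing_rearrangement_def by (meson less_le_trans)
  then have "{i..d} \<subseteq> {i' \<in> {1..d}. a (k i') > c}" using assms(2) by auto
  then have "card {i..d} \<le> card {i' \<in> {1..d}. a (k i') > c}" by (intro card_mono) auto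
  then show ?thesis unfolding card_rearranged[OF assms(1), of "\<lambda>b. b > c"] by simp
qed

text \<open>The \<open>l\<close> values above \<open>c\<close> occupy the last \<open>l\<close>
  positions, so \<open>c\<close> separates positions \<open>d - l\<close> and
  \<open>d - l + 1\<close>. The conventional values 0 and \<infinity> serve the cases
  \<open>l = d\<close> and \<open>l = 0\<close>.\<close>

lemma rearranged_ext_card_gt:
  fixes c :: real
  assumes "nondecreasing_rearrangement d a k" "c \<ge> 0"
  defines "l \<equiv> card {j \<in> {1..d}. a j > c}"
  shows "l \<le> d" "rearranged_ext d a k (d - l) \<le> ereal c"
    "ereal c < rearranged_ext d a k (d - l + 1)"
proof -
  have "l \<le> card {1..d}" unfolding l_def by (intro card_mono) auto
  then show ld: "l \<le> d" by simp
  show "rearranged_ext d a k (d - l) \<le> ereal c"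
  proof (cases "d - l = 0")
    case False
    \<comment> \<open>Otherwise positions \<open>d - l\<close> to \<open>d\<close> would give
      \<open>l + 1\<close> values above \<open>c\<close>.\<close>
    then have "a (k (d - l)) \<le> c"
      using card_gt_ge[OF assms(1), of "d - l" c, folded l_def] ld False
      by (intro leI notI) auto
    then show ?thesis using assms(2) by (auto simp: rearranged_ext_def)
  qed (use assms(2) in \<open>simp add: rearranged_ext_def\<close>)
  show "ereal c < rearranged_ext d a k (d - l + 1)"
  proof (cases "l = 0")
    case False
    then have "d - l + 1 \<in> {1..d}" "d - (d - l + 1) < l" using ld by auto
    then have "a (k (d - l + 1)) > c"
      using card_gt_le[OF assms(1), of "d - l + 1" c, folded l_def] by (meson not_le)
    then show ?thesis using False ld by (simp add: rearranged_ext_def)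
  qed (simp add: rearranged_ext_def)
qed

section \<open>The two parameter choices\<close>

theorem theorem5p2:
  fixes A :: "real ^ 'n ^ 'p" and x :: "real ^ 'p" and ut :: "real ^ 'n"
    and d :: nat and S :: "nat \<Rightarrow> 'n set"
  assumes partition: "partition_on UNIV (S ` {1..d})" "inj_on S {1..d}"
    and orthogonal: "\<And>j k. j \<in> {1..d} \<Longrightarrow> k \<in> {1..d} \<Longrightarrow> j \<noteq> k \<Longrightarrow>
          transpose (submat A (S j)) ** submat A (S k) = 0"
    and solution: "min_norm_solution A x ut"
    and unique: "\<And>u. min_norm_solution A x u \<Longrightarrow> u = ut"
  shows "\<exists>\<beta>1 \<beta>2 :: real. \<beta>1 > 0 \<and> \<beta>2 > 0 \<and>
    (\<forall>(\<delta>::real) (xd :: real ^ 'p) (a :: nat \<Rightarrow> real) (k :: nat \<Rightarrow> nat).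
      \<delta> > 0 \<longrightarrow> norm (xd - x) \<le> \<delta> \<longrightarrow>
      a = (\<lambda>j. infnorm (transpose (submat A (S j)) *v xd)) \<longrightarrow>
      nondecreasing_rearrangement d a k \<longrightarrow>
      (\<forall>l\<in>{0..<d}. a (k (d - l)) > 0 \<longrightarrow>
        (\<exists>u. reg_solution A xd (a (k (d - l))) u \<and> block_sparsity d S u \<le> l \<and>
          norm (u - ut) \<le> a (k (d - l)) * \<beta>2\<^sup>2 / (2 * \<beta>1)
            + \<delta>\<^sup>2 / (2 * a (k (d - l)) * \<beta>1) + \<beta>2 * \<delta> / (sqrt 2 * \<beta>1))) \<and>
      (\<forall>C::real. C > 0 \<longrightarrow>
        (\<exists>l\<in>{0..d}.
          rearranged_ext d a k (d - l) \<le> ereal (C * \<delta>) \<and>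
          ereal (C * \<delta>) < rearranged_ext d a k (d - l + 1) \<and>
          (\<exists>u. reg_solution A xd (C * \<delta>) u \<and> block_sparsity d S u = l \<and>
            norm (u - ut) \<le> (C\<^sup>2 * \<beta>2\<^sup>2 + sqrt 2 * C * \<beta>2 + 1) / (2 * C * \<beta>1) * \<delta>))))"
proof -
  obtain b M where b: "b > 0" and M: "M > 0"
    and sharp: "\<And>u. b * norm (u - ut) \<le> l1_norm u - l1_norm ut + M * norm (A *v u - x)"
    using unique_min_norm_solution_sharp[OF solution unique] by blast
  have Aut: "A *v ut = x"
    using solution by (auto simp: min_norm_solution_def is_arg_min_linorder)
  have UN: "\<Union> (S ` {1..d}) = UNIV" and ne: "\<And>j. j \<in> {1..d} \<Longrightarrow> S j \<noteq> {}"
    using partition(1) by (auto simp: partition_on_def)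
  have sparsity: "block_sparsity d S u =
      card {j \<in> {1..d}. infnorm (transpose (submat A (S j)) *v xd) > lam}"
    if "reg_solution A xd lam u" "lam > 0" for xd lam u
  proof -
    have "subvec u (S j) \<noteq> 0 \<longleftrightarrow> infnorm (transpose (submat A (S j)) *v xd) > lam"
      if "j \<in> {1..d}" for j
      using reg_solution_block_nonzero_iff[OF \<open>reg_solution A xd lam u\<close> \<open>lam > 0\<close> ne[OF that]]
        orthogonal_columns_of_partition[OF UN orthogonal that] by blast
    then show ?thesis unfolding block_sparsity_def by (intro arg_cong[of _ _ card]) blast
  qed
  have error: "norm (u - ut) \<le>
      lam * (sqrt 2 * M)\<^sup>2 / (2 * b) + \<delta>\<^sup>2 / (2 * lam * b) + sqrt 2 * M * \<delta> / (sqrt 2 * b)"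
    if "reg_solution A xd lam u" "lam > 0" "norm (xd - x) \<le> \<delta>" for xd lam u \<delta>
    using reg_solution_error[of A xd lam u b M ut \<delta>] that b M sharp[of u] by (simp add: Aut)
  show ?thesis
  \<comment> \<open>Both constants come from sharpness at \<open>ut\<close> and are fixed before the
    noise level and the data.\<close>
  proof (rule exI[of _ b], rule exI[of _ "sqrt 2 * M"], intro conjI allI impI)
    fix \<delta> :: real and xd :: "real ^ 'p" and a :: "nat \<Rightarrow> real" and k :: "nat \<Rightarrow> nat"
    assume \<delta>: "\<delta> > 0" "norm (xd - x) \<le> \<delta>"
      and a: "a = (\<lambda>j. infnorm (transpose (submat A (S j)) *v xd))"
      and k: "nondecreasing_rearrangement d a k"
    show "\<forall>l\<in>{0..<d}. a (k (d - l)) > 0 \<longrightarrow>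
        (\<exists>u. reg_solution A xd (a (k (d - l))) u \<and> block_sparsity d S u \<le> l \<and>
          norm (u - ut) \<le> a (k (d - l)) * (sqrt 2 * M)\<^sup>2 / (2 * b)
            + \<delta>\<^sup>2 / (2 * a (k (d - l)) * b) + sqrt 2 * M * \<delta> / (sqrt 2 * b))"
    proof (intro ballI impI)
      fix l assume l: "l \<in> {0..<d}" and pos: "a (k (d - l)) > 0"
      obtain u where u: "reg_solution A xd (a (k (d - l))) u"
        using reg_solution_exists[OF pos] by blast
      have "block_sparsity d S u = card {j \<in> {1..d}. a j > a (k (d - l))}"
        using sparsity[OF u pos] by (simp add: a)
      \<comment> \<open>The parameter is itself the value at position \<open>d - l\<close>. Ties
        with it further up give zero blocks, so the count may fall below \<open>l\<close>.\<close>
      also have "\<dots> \<le> l" using card_gt_le[OF k, of "d - l" "a (k (d - l))"] l by auto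
      finally show "\<exists>u. reg_solution A xd (a (k (d - l))) u \<and> block_sparsity d S u \<le> l \<and>
          norm (u - ut) \<le> a (k (d - l)) * (sqrt 2 * M)\<^sup>2 / (2 * b)
            + \<delta>\<^sup>2 / (2 * a (k (d - l)) * b) + sqrt 2 * M * \<delta> / (sqrt 2 * b)"
        using u error[OF u pos \<delta>(2)] by blast
    qed
    fix C :: real assume C: "C > 0"
    then have pos: "C * \<delta> > 0" using \<delta> by simp
    \<comment> \<open>Counting the values above \<open>C * \<delta>\<close> gives the exact block
      sparsity and also the position where \<open>C * \<delta>\<close> falls in the
      ordering.\<close>
    define l where "l = card {j \<in> {1..d}. a j > C * \<delta>}"
    obtain u where u: "reg_solution A xd (C * \<delta>) u"
      using reg_solution_exists[OF pos] by blast
    have "block_sparsity d S u = l" using sparsity[OF u pos] by (simp add: a l_def)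
    \<comment> \<open>With \<open>lam = C * \<delta>\<close> all three terms of the error bound are
      linear in \<open>\<delta>\<close>; they are brought over the denominator
      \<open>2 * C * b\<close>.\<close>
    moreover have "C * \<delta> * (sqrt 2 * M)\<^sup>2 / (2 * b) + \<delta>\<^sup>2 / (2 * (C * \<delta>) * b)
        + sqrt 2 * M * \<delta> / (sqrt 2 * b)
      = (C\<^sup>2 * (sqrt 2 * M)\<^sup>2 + sqrt 2 * C * (sqrt 2 * M) + 1) / (2 * C * b) * \<delta>"
      using b C \<delta>(1) by (simp add: field_simps power2_eq_square)
    ultimately show "\<exists>l\<in>{0..d}.
        rearranged_ext d a k (d - l) \<le> ereal (C * \<delta>) \<and>
        ereal (C * \<delta>) < rearranged_ext d a k (d - l + 1) \<and>
        (\<exists>u. reg_solution A xd (C * \<delta>) u \<and> block_sparsity d S u = l \<and>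
          norm (u - ut) \<le> (C\<^sup>2 * (sqrt 2 * M)\<^sup>2 + sqrt 2 * C * (sqrt 2 * M) + 1) / (2 * C * b) * \<delta>)"
      using rearranged_ext_card_gt[OF k less_imp_le[OF pos], folded l_def] u
        error[OF u pos \<delta>(2)] by (intro bexI[of _ l]) auto
  qed (use b M in auto)
qed

end
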